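(* Let $\mathbf{\Sigma}=\{(\mathbf{x}_t,\tilde B_t)\}_{t\in\mathbb{T}_n}$ be an $(\mathbf{r},\mathbf{z})$-cluster pattern with root vertex $t_0$ and let $B_t$ be the principal part of $\tilde B_t$. The $F$-pattern $\{F_t^{B_{t_0};t_0}\}_{t\in\mathbb{T}_n}$ of $\mathbf{\Sigma}$ with respect to $t_0$ is determined by the initial condition $F_{t_0}^{B_{t_0};t_0}=\mathbf{0}_{n\times n}$ and the following mutation formula: whenever $t$ and $t'$ are $k$-adjacent in $\mathbb{T}_n$, for each $\varepsilon\in\{\pm1\}$, $$F_{t'}^{B_{t_0};t_0}=F_t^{B_{t_0};t_0}\bigl(J_n^k+[-\varepsilon B_tR]_+^{\bullet k}\bigr)+[-\varepsilon C_t^{B_{t_0};t_0}R]_+^{\bullet k}+[\varepsilon C_t^{-B_{t_0};t_0}R]_+^{\bullet k}.$$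
   Context: Notation. $m\ge n\ge 1$ are integers, $[1,n]=\{1,\dots,n\}$, $\mathbf{r}=(r_1,\dots,r_n)$ is a tuple of positive integers, $R=\operatorname{diag}(r_1,\dots,r_n)$, $[a]_+=\max(a,0)$, and $[A]_+$ is obtained from a matrix $A$ by applying $[\cdot]_+$ entrywise. $A^{\bullet k}$ is obtained from $A$ by replacing all entries outside the $k$-th column by $0$; $[A]_+^{\bullet k}$ means $([A]_+)^{\bullet k}$. $J_n^k$ is the identity matrix $I_n$ with its $(k,k)$-entry replaced by $-1$. $\mathbf{z}=(z_{i,s})_{1\le i\le n,\,1\le s\le r_i-1}$ are formal variables with the identification $z_{i,s}=z_{i,r_i-s}$; put $z_{i,0}=z_{i,r_i}=1$. $\mathcal{F}=\mathbb{Q}(\mathbf{z},x_1,\dots,x_m)$. Seeds and mutation. A labeled $(\mathbf{r},\mathbf{z})$-seed is a pair $(\mathbf{x},\tilde B)$ where $\tilde B=(b_{ij})$ is an $m\times n$ integer matrix whose principal part $B$ (first $n$ rows) is skew-symmetrizable, and $\mathbf{x}=(x_1,\dots,x_m)$ is an $m$-tuple of elements of $\mathcal{F}$ algebraically independent over $\mathbb{Q}(\mathbf{z})$. For $k\in[1,n]$, $\mu_k(\mathbf{x},\tilde B)=(\mathbf{x}',\tilde B')$ with $x_i'=x_i$ for $i\ne k$, $x_k'=x_k^{-1}\bigl(\prod_{j=1}^m x_j^{[-\varepsilon b_{jk}]_+}\bigr)^{r_k}\sum_{s=0}^{r_k}z_{k,s}\hat y_k^{\varepsilon s}$, $\hat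 y_k=\prod_{j=1}^m x_j^{b_{jk}}$; and $b'_{ij}=-b_{ij}$ if $i=k$ or $j=k$, $b'_{ij}=b_{ij}+r_k([-\varepsilon b_{ik}]_+b_{kj}+b_{ik}[\varepsilon b_{kj}]_+)$ otherwise (independent of $\varepsilon\in\{\pm1\}$). $\mathbb{T}_n$ is the $n$-regular tree with edges labeled by $[1,n]$ so that the $n$ edges at each vertex have distinct labels; vertices joined by an edge labeled $k$ are called $k$-adjacent. An $(\mathbf{r},\mathbf{z})$-cluster pattern assigns to each $t\in\mathbb{T}_n$ a seed $(\mathbf{x}_t,\tilde B_t)$, $\tilde B_t=(b_{ij;t})$, such that seeds at $k$-adjacent vertices are related by $\mu_k$. $C$-matrices. For the root vertex $t_0$, $C_t=C_t^{B_{t_0};t_0}=(c_{ij;t})_{i,j=1}^n$ is defined by $C_{t_0}=I_n$ and, for $t,t'$ $k$-adjacent, $c_{ij;t'}=-c_{ij;t}$ if $j=k$, $c_{ij;t'}=c_{ij;t}+r_k(c_{ik;t}[\varepsilon b_{kj;t}]_++[-\varepsilon c_{ik;t}]_+b_{kj;t})$ if $j\neq k$ (independent of $\varepsilon$). $C_t^{-B_{t_0};t_0}$ is defined by the same recursion with the family $\{B_t\}$ replaced by $\{-B_t\}$ (which is the family obtained by mutation from $-B_{t_0}$ at $t_0$). $F$-polynomials and $F$-pattern. With variables $\hat{\mathbf y}=(\hat y_1,\dots,\hat y_n)$, define $F_{i;t}(\hat{\mathbf y},\mathbf z)$ by $F_{i;t_0}=1$ and, for $t,t'$ $k$-adjacent,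 $F_{i;t'}=F_{i;t}$ for $i\ne k$ and $$F_{k;t'}=F_{k;t}^{-1}\Bigl(\prod_{j=1}^n\hat y_j^{[-\varepsilon c_{jk;t}]_+}F_{j;t}^{[-\varepsilon b_{jk;t}]_+}\Bigr)^{r_k}\sum_{s=0}^{r_k}z_{k,s}\Bigl(\prod_{j=1}^n\hat y_j^{\varepsilon c_{jk;t}}F_{j;t}^{\varepsilon b_{jk;t}}\Bigr)^{s}.$$ It is known that $F_{i;t}\in\mathbb{Z}[\hat{\mathbf y},\mathbf z]$ has constant term $1$ and contains, with coefficient $1$, a unique monomial $\hat{\mathbf y}^{\mathbf f^{t_0}_{i;t}}$ divisible by all monomials in $\hat{\mathbf y}$ occurring in $F_{i;t}$. The vector $\mathbf f^{t_0}_{i;t}\in\mathbb N^n$ is the $i$th $f$-vector, $F^{B_{t_0};t_0}_t=F_t^{t_0}=(\mathbf f^{t_0}_{1;t},\dots,\mathbf f^{t_0}_{n;t})$ is the $F$-matrix at $t$ with respect to $t_0$, and the collection of all $F_t^{t_0}$, $t\in\mathbb{T}_n$, is the $F$-pattern. *)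

theory Defs
  imports
    "Jordan_Normal_Form.Matrix"
    "HOL-Library.Poly_Mapping"
    "HOL-Library.Nat_Bijection"
    "HOL-Computational_Algebra.Fraction_Field"
begin

text \<open>All index ranges are zero-based: the interval $[1,n]$ of the mathematics is rendered as
  \<^term>\<open>{..<n::nat}\<close>, and mutation directions and edge labels are the numbers \<open>k < n\<close>.\<close>

type_synonym 'a mpoly = "(nat \<Rightarrow>\<^sub>0 nat) \<Rightarrow>\<^sub>0 'a"
type_synonym zfield = "rat mpoly fract"
type_synonym ratfun = "zfield mpoly fract"

text \<open>The type \<^typ>\<open>zfield\<close> contains $\mathbb{Q}(\mathbf{z})$, and \<^typ>\<open>ratfun\<close> contains the
  rational functions over $\mathbb{Q}(\mathbf{z})$. Both types have a variable for every natural
  number; the fields for given \<open>m\<close>, \<open>n\<close> and \<open>r\<close> are the subsets \<open>z_field\<close> and \<open>ambient_field\<close>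
  below. The variables of \<^typ>\<open>ratfun\<close> play the role of the $x_j$ in the ambient field of a
  cluster pattern and of the $\hat y_j$ in F-polynomials.\<close>

definition pvar :: "nat \<Rightarrow> 'a::comm_ring_1 mpoly" where
  "pvar j = Poly_Mapping.single (Poly_Mapping.single j 1) 1"

definition of_poly :: "'a::idom mpoly \<Rightarrow> 'a mpoly fract" where
  "of_poly p = Fract p 1"

definition of_coeff :: "'a::idom \<Rightarrow> 'a mpoly fract" where
  "of_coeff c = of_poly (Poly_Mapping.single 0 c)"

definition polys_over :: "'a::zero set \<Rightarrow> nat set \<Rightarrow> 'a mpoly set" where
  "polys_over K X =
     {p. \<forall>u\<in>Poly_Mapping.keys p. Poly_Mapping.lookup p u \<in> K \<and> Poly_Mapping.keys u \<subseteq> X}"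

definition ratfuns_over :: "'a::idom set \<Rightarrow> nat set \<Rightarrow> 'a mpoly fract set" where
  "ratfuns_over K X = {Fract p q |p q. p \<in> polys_over K X \<and> q \<in> polys_over K X \<and> q \<noteq> 0}"

definition eval_poly :: "(nat \<Rightarrow> 'a mpoly fract) \<Rightarrow> 'a::idom mpoly \<Rightarrow> 'a mpoly fract" where
  "eval_poly x p = (\<Sum>u\<in>Poly_Mapping.keys p. of_coeff (Poly_Mapping.lookup p u) *
     (\<Prod>j\<in>Poly_Mapping.keys u. x j ^ Poly_Mapping.lookup u j))"

text \<open>The identification $z_{i,s} = z_{i,r_i-s}$ is built in by using the variable with the smaller
  of the two second indices.\<close>

definition z_coeff :: "(nat \<Rightarrow> nat) \<Rightarrow> nat \<Rightarrow> nat \<Rightarrow> zfield" where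
  "z_coeff r i s = (if s = 0 \<or> s = r i then 1
                    else of_poly (pvar (prod_encode (i, min s (r i - s)))))"

definition z_field :: "nat \<Rightarrow> (nat \<Rightarrow> nat) \<Rightarrow> zfield set" where
  "z_field n r = ratfuns_over UNIV
     {prod_encode (i, min s (r i - s)) |i s. i < n \<and> 1 \<le> s \<and> s \<le> r i - 1}"

definition ambient_field :: "nat \<Rightarrow> nat \<Rightarrow> (nat \<Rightarrow> nat) \<Rightarrow> ratfun set" where
  "ambient_field m n r = ratfuns_over (z_field n r) {..<m}"

definition alg_independent :: "nat \<Rightarrow> (nat \<Rightarrow> nat) \<Rightarrow> ratfun vec \<Rightarrow> bool" where
  "alg_independent n r x \<longleftrightarrow>
     (\<forall>p\<in>polys_over (z_field n r) {..<dim_vec x}. eval_poly (($) x) p = 0 \<longrightarrow> p = 0)"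

definition pos :: "int \<Rightarrow> int" where
  "pos a = max a 0"

definition pos_mat :: "int mat \<Rightarrow> int mat" where
  "pos_mat A = map_mat pos A"

definition only_col :: "nat \<Rightarrow> int mat \<Rightarrow> int mat" where
  "only_col k A = mat (dim_row A) (dim_col A) (\<lambda>(i, j). if j = k then A $$ (i, j) else 0)"

definition J_mat :: "nat \<Rightarrow> nat \<Rightarrow> int mat" where
  "J_mat n k = mat_diag n (\<lambda>i. if i = k then -1 else 1)"

definition R_mat :: "nat \<Rightarrow> (nat \<Rightarrow> nat) \<Rightarrow> int mat" where
  "R_mat n r = mat_diag n (\<lambda>i. int (r i))"

definition principal_part :: "nat \<Rightarrow> int mat \<Rightarrow> int mat" where
  "principal_part n B = mat n n (\<lambda>ij. B $$ ij)"

definition skew_symmetrizable :: "nat \<Rightarrow> int mat \<Rightarrow> bool" where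
  "skew_symmetrizable n B \<longleftrightarrow> B \<in> carrier_mat n n \<and>
     (\<exists>d. (\<forall>i<n. d i > 0) \<and>
          transpose_mat (mat_diag n d * B) = - (mat_diag n d * B))"

type_synonym seed = "ratfun vec \<times> int mat"

fun is_seed :: "nat \<Rightarrow> nat \<Rightarrow> (nat \<Rightarrow> nat) \<Rightarrow> seed \<Rightarrow> bool" where
  "is_seed m n r (x, B) \<longleftrightarrow>
     x \<in> carrier_vec m \<and> (\<forall>j<m. x $ j \<in> ambient_field m n r) \<and> alg_independent n r x \<and>
     B \<in> carrier_mat m n \<and> skew_symmetrizable n (principal_part n B)"

fun seed_mutation :: "nat \<Rightarrow> nat \<Rightarrow> (nat \<Rightarrow> nat) \<Rightarrow> int \<Rightarrow> nat \<Rightarrow> seed \<Rightarrow> seed" where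
  "seed_mutation m n r \<epsilon> k (x, B) =
     (let y = (\<Prod>j<m. (x $ j) powi (B $$ (j, k)))
      in (vec m (\<lambda>i. if i = k
             then inverse (x $ k) * (\<Prod>j<m. (x $ j) powi pos (- \<epsilon> * B $$ (j, k))) ^ r k *
                  (\<Sum>s\<le>r k. of_coeff (z_coeff r k s) * y powi (\<epsilon> * int s))
             else x $ i),
          mat m n (\<lambda>(i, j). if i = k \<or> j = k then - B $$ (i, j)
             else B $$ (i, j) + int (r k) *
                  (pos (- \<epsilon> * B $$ (i, k)) * B $$ (k, j) + B $$ (i, k) * pos (\<epsilon> * B $$ (k, j))))))"

text \<open>\<open>adj k t t'\<close> says that \<open>t\<close> and \<open>t'\<close> are \<open>k\<close>-adjacent.\<close>

definition labeled_regular_tree :: "nat \<Rightarrow> 'v set \<Rightarrow> (nat \<Rightarrow> 'v \<Rightarrow> 'v \<Rightarrow> bool) \<Rightarrow> bool" where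
  "labeled_regular_tree n V adj \<longleftrightarrow>
     V \<noteq> {} \<and>
     (\<forall>k t t'. adj k t t' \<longrightarrow> k < n \<and> t \<in> V \<and> t' \<in> V \<and> t \<noteq> t' \<and> adj k t' t) \<and>
     (\<forall>k l t t'. adj k t t' \<and> adj l t t' \<longrightarrow> k = l) \<and>
     (\<forall>t\<in>V. \<forall>k<n. \<exists>!t'. adj k t t') \<and>
     (\<forall>t\<in>V. \<forall>t'\<in>V. (\<lambda>u v. \<exists>k. adj k u v)\<^sup>*\<^sup>* t t') \<and>
     (\<nexists>ts. 3 \<le> length ts \<and> distinct ts \<and>
           successively (\<lambda>u v. \<exists>k. adj k u v) ts \<and> (\<exists>k. adj k (last ts) (hd ts)))"

definition cluster_pattern ::
    "nat \<Rightarrow> nat \<Rightarrow> (nat \<Rightarrow> nat) \<Rightarrow> 'v set \<Rightarrow> (nat \<Rightarrow> 'v \<Rightarrow> 'v \<Rightarrow> bool) \<Rightarrow> ('v \<Rightarrow> seed) \<Rightarrow> bool" where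
  "cluster_pattern m n r V adj \<Sigma> \<longleftrightarrow>
     (\<forall>t\<in>V. is_seed m n r (\<Sigma> t)) \<and>
     (\<forall>k t t'. adj k t t' \<longrightarrow> (\<forall>\<epsilon>\<in>{1, -1}. \<Sigma> t' = seed_mutation m n r \<epsilon> k (\<Sigma> t)))"

definition pattern_B :: "nat \<Rightarrow> ('v \<Rightarrow> seed) \<Rightarrow> 'v \<Rightarrow> int mat" where
  "pattern_B n \<Sigma> t = principal_part n (snd (\<Sigma> t))"

text \<open>These families are given by an initial value and a recursion along the edges. On a tree such a
  family exists, and it is unique on the vertex set; values outside the vertex set are
  irrelevant.\<close>

definition C_pattern ::
    "nat \<Rightarrow> (nat \<Rightarrow> nat) \<Rightarrow> (nat \<Rightarrow> 'v \<Rightarrow> 'v \<Rightarrow> bool) \<Rightarrow> 'v \<Rightarrow> ('v \<Rightarrow> int mat) \<Rightarrow> ('v \<Rightarrow> int mat) \<Rightarrow> bool"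
  where
  "C_pattern n r adj t\<^sub>0 B C \<longleftrightarrow>
     C t\<^sub>0 = 1\<^sub>m n \<and>
     (\<forall>k t t'. adj k t t' \<longrightarrow> (\<forall>\<epsilon>\<in>{1, -1}.
        C t' = mat n n (\<lambda>(i, j). if j = k then - C t $$ (i, j)
          else C t $$ (i, j) + int (r k) *
               (C t $$ (i, k) * pos (\<epsilon> * B t $$ (k, j)) + pos (- \<epsilon> * C t $$ (i, k)) * B t $$ (k, j)))))"

definition F_polynomials ::
    "nat \<Rightarrow> (nat \<Rightarrow> nat) \<Rightarrow> (nat \<Rightarrow> 'v \<Rightarrow> 'v \<Rightarrow> bool) \<Rightarrow> 'v \<Rightarrow> ('v \<Rightarrow> int mat) \<Rightarrow> ('v \<Rightarrow> int mat) \<Rightarrow>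
     ('v \<Rightarrow> ratfun vec) \<Rightarrow> bool" where
  "F_polynomials n r adj t\<^sub>0 B C F \<longleftrightarrow>
     F t\<^sub>0 = vec n (\<lambda>_. 1) \<and>
     (\<forall>k t t'. adj k t t' \<longrightarrow> (\<forall>\<epsilon>\<in>{1, -1}.
        F t' = vec n (\<lambda>i. if i = k
          then inverse (F t $ k) *
               (\<Prod>j<n. of_poly (pvar j) powi pos (- \<epsilon> * C t $$ (j, k)) *
                       (F t $ j) powi pos (- \<epsilon> * B t $$ (j, k))) ^ r k *
               (\<Sum>s\<le>r k. of_coeff (z_coeff r k s) *
                  (\<Prod>j<n. of_poly (pvar j) powi (\<epsilon> * C t $$ (j, k)) *
                          (F t $ j) powi (\<epsilon> * B t $$ (j, k))) ^ s)
          else F t $ i)))"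

text \<open>\<open>is_f_vector n f v\<close>: the rational function \<open>f\<close> is a polynomial in the variables (over the
  coefficient field $\mathbb{Q}(\mathbf{z})$), and \<open>v\<close> is the exponent vector of the monomial that
  occurs in \<open>f\<close> with coefficient 1 and is divisible by all monomials occurring in \<open>f\<close>. There is at
  most one such \<open>v\<close>; that every F-polynomial has one is a known theorem.\<close>

definition is_f_vector :: "nat \<Rightarrow> ratfun \<Rightarrow> int vec \<Rightarrow> bool" where
  "is_f_vector n f v \<longleftrightarrow> (\<exists>p u. f = of_poly p \<and> Poly_Mapping.lookup p u = 1 \<and>
     (\<forall>w\<in>Poly_Mapping.keys p. \<forall>j. Poly_Mapping.lookup w j \<le> Poly_Mapping.lookup u j) \<and>
     v = vec n (\<lambda>j. int (Poly_Mapping.lookup u j)))"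

definition is_F_matrix :: "nat \<Rightarrow> ratfun vec \<Rightarrow> int mat \<Rightarrow> bool" where
  "is_F_matrix n F M \<longleftrightarrow> M \<in> carrier_mat n n \<and> (\<forall>i<n. is_f_vector n (F $ i) (col M i))"

definition F_pattern ::
    "nat \<Rightarrow> (nat \<Rightarrow> nat) \<Rightarrow> 'v set \<Rightarrow> (nat \<Rightarrow> 'v \<Rightarrow> 'v \<Rightarrow> bool) \<Rightarrow> 'v \<Rightarrow> ('v \<Rightarrow> int mat) \<Rightarrow>
     ('v \<Rightarrow> int mat) \<Rightarrow> bool" where
  "F_pattern n r V adj t\<^sub>0 B M \<longleftrightarrow>
     (\<exists>C F. C_pattern n r adj t\<^sub>0 B C \<and> F_polynomials n r adj t\<^sub>0 B C F \<and>
            (\<forall>t\<in>V. is_F_matrix n (F t) (M t)))"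

definition F_mutation ::
    "nat \<Rightarrow> (nat \<Rightarrow> nat) \<Rightarrow> int \<Rightarrow> nat \<Rightarrow> int mat \<Rightarrow> int mat \<Rightarrow> int mat \<Rightarrow> int mat \<Rightarrow> int mat" where
  "F_mutation n r \<epsilon> k B C C' M =
     M * (J_mat n k + only_col k (pos_mat ((- \<epsilon>) \<cdot>\<^sub>m (B * R_mat n r))))
       + only_col k (pos_mat ((- \<epsilon>) \<cdot>\<^sub>m (C * R_mat n r)))
       + only_col k (pos_mat (\<epsilon> \<cdot>\<^sub>m (C' * R_mat n r)))"

end

theory Submission
  imports Defs
begin

text \<open>
  Clearing denominators, $F_{k;t} F_{k;t'} = \sum_s z_{k,s} Y_+^s Y_-^{r_k - s}$ with
  $Y_\pm = \prod_j \hat y_j^{[\pm c_{jk}]_+} F_j^{[\pm b_{jk}]_+}$. If $X_\pm$ are the exponents of the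
  maximal monomials of $Y_\pm$, then $\mathbf f_{k;t} + \mathbf f_{k;t'} = r_k \max(X_+, X_-)$
  componentwise. Sign-coherence is not needed for the absence of cancellation: since the left-hand
  side has a monomial divisible by all its monomials, it suffices that the monomial with exponent
  $r_k X_+$ survives unless $X_+ \le X_-$, and symmetrically, while for $X_+ = X_-$ the coefficient
  $\sum_s z_{k,s}$ is nonzero. On the other hand $X_+ - X_-$ is the \<open>k\<close>-th column of
  $C_t^{B} + F_t B_t$, and this matrix is $C_t^{-B}$ by induction along the tree.
\<close>

subsection \<open>Maximal monomials\<close>

text \<open>The monomial with exponent \<open>v\<close> need not occur in \<open>p\<close>. This
  weak form passes to products and survives coefficients that vanish.\<close>

definition exponents_le :: "'a::zero mpoly \<Rightarrow> (nat \<Rightarrow>\<^sub>0 nat) \<Rightarrow> bool" where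
  "exponents_le p v \<longleftrightarrow> (\<forall>w\<in>Poly_Mapping.keys p. \<forall>j. Poly_Mapping.lookup w j \<le> Poly_Mapping.lookup v j)"

text \<open>This is the condition on the monomial in \<open>is_f_vector\<close>, with exponents kept
  as finitely supported functions so that they can be added and scaled.\<close>

definition has_top :: "'a::zero_neq_one mpoly \<Rightarrow> (nat \<Rightarrow>\<^sub>0 nat) \<Rightarrow> bool" where
  "has_top p v \<longleftrightarrow> exponents_le p v \<and> Poly_Mapping.lookup p v = 1"

lemma lookup_of_nat_mult:
  fixes v :: "nat \<Rightarrow>\<^sub>0 nat"
  shows "Poly_Mapping.lookup (of_nat k * v) j = k * Poly_Mapping.lookup v j"
  by (induction k) (simp_all add: distrib_right lookup_add)

lemma exponents_leD:
  assumes "exponents_le p v" and "Poly_Mapping.lookup p w \<noteq> 0"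
  shows "Poly_Mapping.lookup w j \<le> Poly_Mapping.lookup v j"
  using assms by (auto simp: exponents_le_def in_keys_iff)

lemma exponents_le_mult:
  fixes p q :: "'a::semiring_0 mpoly"
  assumes "exponents_le p v" and "exponents_le q w"
  shows "exponents_le (p * q) (v + w)"
  unfolding exponents_le_def
proof (intro ballI allI)
  fix x j
  assume "x \<in> Poly_Mapping.keys (p * q)"
  then obtain a b where "x = a + b" "a \<in> Poly_Mapping.keys p" "b \<in> Poly_Mapping.keys q"
    using keys_mult by blast
  then show "Poly_Mapping.lookup x j \<le> Poly_Mapping.lookup (v + w) j"
    using assms by (auto simp: exponents_le_def lookup_add intro!: add_mono)
qed

text \<open>If \<open>l + x = v + w\<close> with \<open>l\<close> below \<open>v\<close> and
  \<open>x\<close> below \<open>w\<close> in every coordinate, then \<open>l = v\<close> and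
  \<open>x = w\<close>. So the convolution has at most one nonzero term.\<close>

lemma lookup_mult_top:
  fixes p q :: "'a::semiring_0 mpoly"
  assumes "exponents_le p v" and "exponents_le q w"
  shows "Poly_Mapping.lookup (p * q) (v + w) = Poly_Mapping.lookup p v * Poly_Mapping.lookup q w"
proof -
  have "Poly_Mapping.lookup p l * (\<Sum>x. Poly_Mapping.lookup q x when v + w = l + x) =
      (Poly_Mapping.lookup p v * Poly_Mapping.lookup q w when l = v)" for l
  proof (cases "l = v")
    case False
    have "Poly_Mapping.lookup q x = 0" if "Poly_Mapping.lookup p l \<noteq> 0" "v + w = l + x" for x
    proof (rule ccontr)
      assume "Poly_Mapping.lookup q x \<noteq> 0"
      then have "Poly_Mapping.lookup x j \<le> Poly_Mapping.lookup w j" for j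
        using assms(2) exponents_leD by blast
      moreover have "Poly_Mapping.lookup l j \<le> Poly_Mapping.lookup v j" for j
        using assms(1) exponents_leD that(1) by blast
      moreover have "Poly_Mapping.lookup v j + Poly_Mapping.lookup w j =
          Poly_Mapping.lookup l j + Poly_Mapping.lookup x j" for j
        using that(2) by (metis lookup_add)
      ultimately have "Poly_Mapping.lookup l j = Poly_Mapping.lookup v j" for j
        by (metis add_le_cancel_right add_mono_thms_linordered_semiring(1) le_antisym
            nat_add_left_cancel_le)
      with False show False
        by (simp add: poly_mapping_eqI)
    qed
    then have "(\<Sum>x. Poly_Mapping.lookup q x when v + w = l + x) = 0"
      if "Poly_Mapping.lookup p l \<noteq> 0"
      using that by (simp add: when_def cong: if_cong)
    then show ?thesis using False by fastforce
  next
    case True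
    then show ?thesis by simp
  qed
  then show ?thesis
    by (simp add: lookup_mult)
qed

lemma has_top_nonzero: "has_top p v \<Longrightarrow> p \<noteq> 0"
  by (auto simp: has_top_def)

lemma has_top_one: "has_top (1 :: 'a::semiring_1 mpoly) 0"
  by (simp add: has_top_def exponents_le_def lookup_one in_keys_iff)

lemma has_top_mult:
  fixes p q :: "'a::semiring_1 mpoly"
  shows "has_top p v \<Longrightarrow> has_top q w \<Longrightarrow> has_top (p * q) (v + w)"
  by (simp add: has_top_def exponents_le_mult lookup_mult_top)

lemma has_top_power:
  fixes p :: "'a::comm_semiring_1 mpoly"
  assumes "has_top p v"
  shows "has_top (p ^ k) (of_nat k * v)"
proof (induction k)
  case (Suc k)
  then show ?case
    using has_top_mult[OF assms Suc.IH] by (simp add: distrib_right)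
qed (simp add: has_top_one)

lemma has_top_prod:
  fixes p :: "'b \<Rightarrow> 'a::comm_semiring_1 mpoly"
  assumes "\<And>i. i \<in> A \<Longrightarrow> has_top (p i) (v i)"
  shows "has_top (\<Prod>i\<in>A. p i) (\<Sum>i\<in>A. v i)"
  using assms by (induction A rule: infinite_finite_induct) (simp_all add: has_top_one has_top_mult)

lemma has_top_pvar: "has_top (pvar j :: 'a::comm_ring_1 mpoly) (Poly_Mapping.single j 1)"
  by (simp add: has_top_def exponents_le_def pvar_def lookup_single in_keys_iff when_def)

text \<open>The term with index \<open>s\<close> is bounded by an exponent \<open>e s\<close> that
  moves linearly from \<open>r * b\<close> at \<open>s = 0\<close> to \<open>r * a\<close> at
  \<open>s = r\<close>; this bounds \<open>w\<close> from above. From below it suffices to find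
  large exponents that really occur in \<open>S\<close>, since \<open>w\<close> dominates them
  all.\<close>

lemma top_exchange_sum:
  fixes P Q :: "'a::idom mpoly" and z :: "nat \<Rightarrow> 'a" and r :: nat
  defines "S \<equiv> \<Sum>s\<le>r. Poly_Mapping.single 0 (z s) * (P ^ s * Q ^ (r - s))"
  assumes P: "has_top P a" and Q: "has_top Q b" and S: "has_top S w"
    and z: "z 0 = 1" "z r = 1" "(\<Sum>s\<le>r. z s) \<noteq> 0"
  shows "Poly_Mapping.lookup w j = r * max (Poly_Mapping.lookup a j) (Poly_Mapping.lookup b j)"
proof -
  define T where "T s = Poly_Mapping.single 0 (z s) * (P ^ s * Q ^ (r - s))" for s
  define e where "e s = of_nat s * a + of_nat (r - s) * b" for s
  have lookup_e: "Poly_Mapping.lookup (e s) i =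
      s * Poly_Mapping.lookup a i + (r - s) * Poly_Mapping.lookup b i" for s i
    by (simp add: e_def lookup_add lookup_of_nat_mult)
  have PQ: "has_top (P ^ s * Q ^ (r - s)) (e s)" for s
    unfolding e_def by (intro has_top_mult has_top_power P Q)
  have const: "exponents_le (Poly_Mapping.single 0 (z s)) 0" for s
    by (simp add: exponents_le_def)
  have T_le: "exponents_le (T s) (e s)" for s
    using exponents_le_mult[OF const] PQ unfolding T_def has_top_def by (metis add_0)
  have T_top: "Poly_Mapping.lookup (T s) (e s) = z s" for s
    using lookup_mult_top[OF const, of "P ^ s * Q ^ (r - s)" "e s" s] PQ[of s]
    unfolding T_def has_top_def by simp
  have lookup_S: "Poly_Mapping.lookup S x = (\<Sum>s\<le>r. Poly_Mapping.lookup (T s) x)" for x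
    unfolding S_def T_def by (simp add: lookup_sum)
  have w_ge: "Poly_Mapping.lookup x i \<le> Poly_Mapping.lookup w i"
    if "Poly_Mapping.lookup S x \<noteq> 0" for x i
    using S that exponents_leD by (auto simp: has_top_def)
  have w_le: "Poly_Mapping.lookup w i \<le> r * max (Poly_Mapping.lookup a i) (Poly_Mapping.lookup b i)" for i
  proof -
    have "Poly_Mapping.lookup S w \<noteq> 0"
      using S by (simp add: has_top_def)
    then obtain s where s: "s \<le> r" "Poly_Mapping.lookup (T s) w \<noteq> 0"
      unfolding lookup_S by (meson atMost_iff sum.neutral)
    have "Poly_Mapping.lookup w i \<le> s * Poly_Mapping.lookup a i + (r - s) * Poly_Mapping.lookup b i"
      using exponents_leD[OF T_le s(2)] by (simp add: lookup_e)
    also have "\<dots> \<le> s * max (Poly_Mapping.lookup a i) (Poly_Mapping.lookup b i) +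
        (r - s) * max (Poly_Mapping.lookup a i) (Poly_Mapping.lookup b i)"
      by (intro add_mono mult_left_mono) auto
    also have "\<dots> = r * max (Poly_Mapping.lookup a i) (Poly_Mapping.lookup b i)"
      using s(1) by (simp flip: add_mult_distrib)
    finally show ?thesis .
  qed
  \<comment> \<open>A term bounded by \<open>e l\<close> cannot contain the exponent
    \<open>e s\<close> if the latter is larger in a single coordinate \<open>i\<close>. Hence
    nothing cancels against term \<open>s\<close>.\<close>
  have single_term: "Poly_Mapping.lookup S (e s) = z s"
    if "s \<le> r" and *: "\<And>l. l \<le> r \<Longrightarrow> l \<noteq> s \<Longrightarrow> Poly_Mapping.lookup (e l) i < Poly_Mapping.lookup (e s) i"
    for s i
  proof -
    have "Poly_Mapping.lookup (T l) (e s) = (if l = s then z s else 0)" if "l \<le> r" for l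
      using exponents_leD[OF T_le, of l "e s" i] *[OF that] T_top by (auto simp: not_le[symmetric])
    then show ?thesis
      using \<open>s \<le> r\<close> by (simp add: lookup_S)
  qed
  \<comment> \<open>One coordinate \<open>i\<close> where \<open>a\<close> exceeds \<open>b\<close>
    makes \<open>e r\<close> the strict maximum there, so \<open>r * a\<close> occurs in
    \<open>S\<close> with coefficient \<open>z r = 1\<close>. Then \<open>w\<close> dominates it in
    every coordinate, in particular in \<open>j\<close>.\<close>
  have w_ge_a: "r * Poly_Mapping.lookup a j \<le> Poly_Mapping.lookup w j"
    if "Poly_Mapping.lookup a i > Poly_Mapping.lookup b i" for i
  proof -
    have "Poly_Mapping.lookup (e l) i < Poly_Mapping.lookup (e r) i" if "l \<le> r" "l \<noteq> r" for l
    proof -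
      have "(r - l) * Poly_Mapping.lookup b i < (r - l) * Poly_Mapping.lookup a i"
        using \<open>Poly_Mapping.lookup a i > Poly_Mapping.lookup b i\<close> that by simp
      then have "Poly_Mapping.lookup (e l) i < (l + (r - l)) * Poly_Mapping.lookup a i"
        unfolding lookup_e add_mult_distrib by simp
      then show ?thesis using that by (simp add: lookup_e)
    qed
    from single_term[OF _ this] have "Poly_Mapping.lookup S (e r) \<noteq> 0"
      using z by simp
    from w_ge[OF this, of j] show ?thesis by (simp add: lookup_e)
  qed
  \<comment> \<open>The mirror image: \<open>e 0\<close>, which is \<open>r * b\<close>, occurs with
    coefficient \<open>z 0 = 1\<close>.\<close>
  have w_ge_b: "r * Poly_Mapping.lookup b j \<le> Poly_Mapping.lookup w j"
    if "Poly_Mapping.lookup b i > Poly_Mapping.lookup a i" for i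
  proof -
    have "Poly_Mapping.lookup (e l) i < Poly_Mapping.lookup (e 0) i" if "l \<le> r" "l \<noteq> 0" for l
    proof -
      have "l * Poly_Mapping.lookup a i < l * Poly_Mapping.lookup b i"
        using \<open>Poly_Mapping.lookup b i > Poly_Mapping.lookup a i\<close> that by simp
      then have "Poly_Mapping.lookup (e l) i < (l + (r - l)) * Poly_Mapping.lookup b i"
        unfolding lookup_e add_mult_distrib by simp
      then show ?thesis using that by (simp add: lookup_e)
    qed
    from single_term[OF _ this] have "Poly_Mapping.lookup S (e 0) \<noteq> 0"
      using z by simp
    from w_ge[OF this, of j] show ?thesis by (simp add: lookup_e)
  qed
  show ?thesis
  proof (cases "a = b")
    case True
    \<comment> \<open>All the bounds \<open>e s\<close> coincide here, so the leading coefficients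
      add up; this is where the nonvanishing of their sum enters.\<close>
    have e_eq: "e s = e 0" if "s \<le> r" for s
      using that True by (intro poly_mapping_eqI) (simp add: lookup_e flip: add_mult_distrib)
    have "Poly_Mapping.lookup (T s) (e 0) = z s" if "s \<le> r" for s
      using T_top[of s] e_eq[OF that] by metis
    then have "Poly_Mapping.lookup S (e 0) = (\<Sum>s\<le>r. z s)"
      by (simp add: lookup_S)
    then have "Poly_Mapping.lookup S (e 0) \<noteq> 0"
      using z by simp
    from w_ge[OF this, of j] w_le[of j] True show ?thesis by (simp add: lookup_e)
  next
    case False
    then obtain i where "Poly_Mapping.lookup a i \<noteq> Poly_Mapping.lookup b i"
      using poly_mapping_eqI[of a b] by auto
    then consider "Poly_Mapping.lookup a i > Poly_Mapping.lookup b i"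
      | "Poly_Mapping.lookup a i < Poly_Mapping.lookup b i" by linarith
    then have "r * max (Poly_Mapping.lookup a j) (Poly_Mapping.lookup b j) \<le> Poly_Mapping.lookup w j"
    proof cases
      case 1
      \<comment> \<open>At \<open>j\<close> either \<open>a\<close> attains the maximum, or
        \<open>b\<close> is larger and \<open>j\<close> itself is the witness coordinate for
        \<open>w_ge_b\<close>.\<close>
      show ?thesis
        using w_ge_a[OF 1] w_ge_b[of j]
        by (cases "Poly_Mapping.lookup a j < Poly_Mapping.lookup b j") (simp_all add: max_def)
    next
      case 2
      show ?thesis
        using w_ge_b[OF 2] w_ge_a[of j]
        by (cases "Poly_Mapping.lookup b j < Poly_Mapping.lookup a j") (simp_all add: max_def)
    qed
    with w_le[of j] show ?thesis by (rule le_antisym)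
  qed
qed

section \<open>Embedding of polynomials into their fraction field\<close>

lemma of_poly_0 [simp]: "of_poly 0 = 0"
  by (simp add: of_poly_def Zero_fract_def)

lemma of_poly_1 [simp]: "of_poly 1 = 1"
  by (simp add: of_poly_def One_fract_def)

lemma of_poly_add: "of_poly (p + q) = of_poly p + of_poly q"
  by (simp add: of_poly_def)

lemma of_poly_mult: "of_poly (p * q) = of_poly p * of_poly q"
  by (simp add: of_poly_def)

lemma of_poly_power: "of_poly (p ^ k) = of_poly p ^ k"
  by (induction k) (simp_all add: of_poly_mult)

lemma of_poly_sum: "of_poly (\<Sum>i\<in>A. p i) = (\<Sum>i\<in>A. of_poly (p i))"
  by (induction A rule: infinite_finite_induct) (simp_all add: of_poly_add)

lemma of_poly_prod: "of_poly (\<Prod>i\<in>A. p i) = (\<Prod>i\<in>A. of_poly (p i))"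
  by (induction A rule: infinite_finite_induct) (simp_all add: of_poly_mult)

lemma of_poly_eq_iff [simp]: "of_poly p = of_poly q \<longleftrightarrow> p = q"
  by (simp add: of_poly_def eq_fract)

lemma of_poly_eq_0_iff [simp]: "of_poly p = 0 \<longleftrightarrow> p = 0"
  by (metis of_poly_0 of_poly_eq_iff)

text \<open>The sum comes from a polynomial over the rationals with positive constant coefficient:
  the term \<open>s = 0\<close> contributes 1 and every other term 0 or 1.\<close>

lemma sum_z_coeff_nonzero: "(\<Sum>s\<le>r k. z_coeff r k s) \<noteq> 0"
proof -
  define p :: "nat \<Rightarrow> rat mpoly" where
    "p s = (if s = 0 \<or> s = r k then 1 else pvar (prod_encode (k, min s (r k - s))))" for s
  have "0 \<le> Poly_Mapping.lookup (p s) 0" for s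
    by (auto simp: p_def pvar_def lookup_single when_def)
  then have "0 < (\<Sum>s\<le>r k. Poly_Mapping.lookup (p s) 0)"
    by (intro sum_pos2[of _ 0]) (auto simp: p_def)
  then have "(\<Sum>s\<le>r k. p s) \<noteq> 0"
    by (metis less_irrefl lookup_sum lookup_zero)
  moreover have "z_coeff r k s = of_poly (p s)" for s
    by (simp add: p_def z_coeff_def)
  ultimately show ?thesis
    by (simp flip: of_poly_sum)
qed

subsection \<open>The exchange relation\<close>

lemma pos_nonneg [simp]: "0 \<le> pos a"
  by (simp add: pos_def)

lemma pos_minus: "pos (- a) = pos a - a"
  by (simp add: pos_def)

lemma pos_mult_left: "0 \<le> c \<Longrightarrow> pos (c * a) = c * pos a"
  by (cases "c = 0") (auto simp: pos_def max_def mult_le_0_iff zero_le_mult_iff)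

text \<open>Clears denominators: the extra factor turns a Laurent power into an ordinary one, which
  is how \<open>Y_+\<close> arises from \<open>Y_-\<close>.\<close>

lemma power_int_pos_split:
  fixes x :: "'a::field"
  assumes "x \<noteq> 0"
  shows "x powi a * x powi pos (- a) = x ^ nat (pos a)"
  using assms by (simp add: pos_minus flip: power_int_add power_int_of_nat)

text \<open>Here \<open>c\<close> and \<open>b\<close> stand for the \<open>k\<close>-th columns of
  the C-matrix and the exchange matrix, and \<open>mut\<close> is the recursion with sign 1.
  Multiplication by \<open>p k\<close> gives an identity of polynomials whose left side
  \<open>p k * p'\<close> has a known top, so \<open>top_exchange_sum\<close> applies.\<close>

lemma f_vectors_exchange:
  fixes p :: "nat \<Rightarrow> zfield mpoly" and p' :: "zfield mpoly" and u :: "nat \<Rightarrow> nat \<Rightarrow>\<^sub>0 nat"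
  assumes p: "\<And>i. i < n \<Longrightarrow> has_top (p i) (u i)" and p': "has_top p' u'" and k: "k < n"
    and mut: "of_poly p' = inverse (of_poly (p k)) *
      (\<Prod>j<n. of_poly (pvar j) powi pos (- c j) * of_poly (p j) powi pos (- b j)) ^ r k *
      (\<Sum>s\<le>r k. of_coeff (z_coeff r k s) *
        (\<Prod>j<n. of_poly (pvar j) powi c j * of_poly (p j) powi b j) ^ s)"
    and i: "i < n"
  defines "f \<equiv> \<lambda>l. int (Poly_Mapping.lookup (u l) i)"
  shows "int (Poly_Mapping.lookup u' i) + f k =
    int (r k) * max (pos (c i) + (\<Sum>l<n. f l * pos (b l))) (pos (- c i) + (\<Sum>l<n. f l * pos (- b l)))"
proof -
  \<comment> \<open>Negating both columns turns \<open>Y_+\<close> into \<open>Y_-\<close>, so one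
    definition serves for both.\<close>
  define Y where "Y c b = (\<Prod>j<n. pvar j ^ nat (pos (c j)) * p j ^ nat (pos (b j)))" for c b :: "nat \<Rightarrow> int"
  define X where "X c b = (\<Sum>j<n. of_nat (nat (pos (c j))) * Poly_Mapping.single j 1 + of_nat (nat (pos (b j))) * u j)"
    for c b :: "nat \<Rightarrow> int"
  have Y_top: "has_top (Y c b) (X c b)" for c b
    unfolding X_def Y_def
    by (intro has_top_prod has_top_mult has_top_power has_top_pvar p) simp
  have X: "int (Poly_Mapping.lookup (X c b) i) = pos (c i) + (\<Sum>l<n. f l * pos (b l))" for c b
  proof -
    \<comment> \<open>Among the variables only the one with index \<open>i\<close> contributes to
      coordinate \<open>i\<close>.\<close>
    have "int (Poly_Mapping.lookup (X c b) i) =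
        (\<Sum>l<n. (if l = i then pos (c l) else 0) + pos (b l) * f l)"
      by (auto simp: X_def lookup_sum lookup_add lookup_of_nat_mult lookup_single when_def f_def
          intro!: sum.cong)
    then show ?thesis using i by (simp add: sum.distrib mult.commute)
  qed
  define Ym Yp where "Ym = Y (\<lambda>j. - c j) (\<lambda>j. - b j)" and "Yp = Y c b"
  define q where "q = (\<Prod>j<n. of_poly (pvar j) powi c j * of_poly (p j) powi b j)"
  have nz: "p j \<noteq> 0" if "j < n" for j
    by (rule has_top_nonzero[OF p[OF that]])
  have nz_var: "(pvar j :: zfield mpoly) \<noteq> 0" for j
    by (rule has_top_nonzero[OF has_top_pvar])
  have nat_powi: "x powi pos a = x ^ nat (pos a)" for x :: ratfun and a
    by (simp add: power_int_def)
  have Ym: "(\<Prod>j<n. of_poly (pvar j) powi pos (- c j) * of_poly (p j) powi pos (- b j)) = of_poly Ym"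
    by (simp add: Ym_def Y_def of_poly_prod of_poly_mult of_poly_power nat_powi)
  \<comment> \<open>The quotient \<open>q\<close> is \<open>Y_+ / Y_-\<close>; its factors are
    matched with those of \<open>Ym\<close> index by index.\<close>
  have "q * of_poly Ym = (\<Prod>j<n. (of_poly (pvar j) powi c j * of_poly (pvar j) powi pos (- c j)) *
      (of_poly (p j) powi b j * of_poly (p j) powi pos (- b j)))"
    unfolding q_def Ym[symmetric] prod.distrib[symmetric] by (intro prod.cong) simp_all
  also have "\<dots> = of_poly Yp"
    unfolding Yp_def Y_def of_poly_prod of_poly_mult of_poly_power
    by (intro prod.cong refl arg_cong2[of _ _ _ _ "(*)"] power_int_pos_split) (auto simp: nz nz_var)
  finally have q: "q * of_poly Ym = of_poly Yp" .
  have "of_poly (p k * p') = of_poly Ym ^ r k * (\<Sum>s\<le>r k. of_coeff (z_coeff r k s) * q ^ s)"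
    unfolding of_poly_mult mut Ym q_def[symmetric] using nz[OF k] by (simp add: mult.assoc)
  also have "\<dots> = (\<Sum>s\<le>r k. of_coeff (z_coeff r k s) * ((q * of_poly Ym) ^ s * of_poly Ym ^ (r k - s)))"
    unfolding sum_distrib_left
  proof (intro sum.cong refl)
    fix s assume "s \<in> {..r k}"
    \<comment> \<open>Of the \<open>r k\<close> copies of \<open>Ym\<close>, \<open>s\<close> clear
      the denominators of \<open>q ^ s\<close> and the others remain.\<close>
    then have "of_poly Ym ^ r k = of_poly Ym ^ s * of_poly Ym ^ (r k - s)"
      by (simp flip: power_add)
    then show "of_poly Ym ^ r k * (of_coeff (z_coeff r k s) * q ^ s) =
        of_coeff (z_coeff r k s) * ((q * of_poly Ym) ^ s * of_poly Ym ^ (r k - s))"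
      by (simp add: power_mult_distrib mult_ac)
  qed
  also have "\<dots> = of_poly (\<Sum>s\<le>r k. Poly_Mapping.single 0 (z_coeff r k s) * (Yp ^ s * Ym ^ (r k - s)))"
    unfolding q by (simp add: of_poly_sum of_poly_mult of_poly_power of_coeff_def)
  \<comment> \<open>Injectivity of \<open>of_poly\<close> leads back from fractions to
    polynomials.\<close>
  finally have S: "p k * p' = (\<Sum>s\<le>r k. Poly_Mapping.single 0 (z_coeff r k s) * (Yp ^ s * Ym ^ (r k - s)))"
    by simp
  have "has_top (\<Sum>s\<le>r k. Poly_Mapping.single 0 (z_coeff r k s) * (Yp ^ s * Ym ^ (r k - s))) (u k + u')"
    unfolding S[symmetric] by (rule has_top_mult[OF p[OF k] p'])
  then have "Poly_Mapping.lookup (u k + u') i = r k * max (Poly_Mapping.lookup (X c b) i)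
      (Poly_Mapping.lookup (X (\<lambda>j. - c j) (\<lambda>j. - b j)) i)"
    by (intro top_exchange_sum[where P = Yp and Q = Ym and r = "r k" and z = "z_coeff r k"])
      (auto simp: Yp_def Ym_def Y_top sum_z_coeff_nonzero, simp_all add: z_coeff_def)
  then have "int (Poly_Mapping.lookup u' i) + f k = int (r k) * max (int (Poly_Mapping.lookup (X c b) i))
      (int (Poly_Mapping.lookup (X (\<lambda>j. - c j) (\<lambda>j. - b j)) i))"
    by (simp add: lookup_add f_def flip: of_nat_max of_nat_mult of_nat_add)
  then show ?thesis by (simp add: X)
qed

subsection \<open>Recursions on the tree\<close>

text \<open>The tree is connected, so every vertex is the end of a path of edges from the
  root.\<close>

lemma labeled_regular_tree_induct:
  assumes "labeled_regular_tree n V adj" and "t\<^sub>0 \<in> V" and "t \<in> V"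
    and "P t\<^sub>0"
    and step: "\<And>k t t'. adj k t t' \<Longrightarrow> P t \<Longrightarrow> P t'"
  shows "P t"
proof -
  have "(\<lambda>u v. \<exists>k. adj k u v)\<^sup>*\<^sup>* t\<^sub>0 t"
    using assms(1-3) by (simp add: labeled_regular_tree_def)
  then show ?thesis
    by (induction rule: rtranclp_induct) (use assms(4) step in auto)
qed

lemma labeled_regular_treeD:
  assumes "labeled_regular_tree n V adj" and "adj k t t'"
  shows "k < n" "t \<in> V" "t' \<in> V"
  using assms by (auto simp: labeled_regular_tree_def)

text \<open>The instance of the recursion at sign 1, the only form needed for the induction along
  edges.\<close>

lemma C_pattern_step:
  assumes "C_pattern n r adj t\<^sub>0 B C" and "adj k t t'"
  shows "C t' = mat n n (\<lambda>(i, j). if j = k then - C t $$ (i, j)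
          else C t $$ (i, j) + int (r k) *
               (C t $$ (i, k) * pos (B t $$ (k, j)) + pos (- C t $$ (i, k)) * B t $$ (k, j)))"
  using assms unfolding C_pattern_def by fastforce

text \<open>\<open>F_pattern\<close> hides a C-family behind an existential quantifier; this
  identifies it on the vertices with the given one.\<close>

lemma C_pattern_unique:
  assumes tree: "labeled_regular_tree n V adj" "t\<^sub>0 \<in> V" "t \<in> V"
    and C: "C_pattern n r adj t\<^sub>0 B C" and C': "C_pattern n r adj t\<^sub>0 B C'"
  shows "C t = C' t"
  using tree
proof (rule labeled_regular_tree_induct)
  show "C t\<^sub>0 = C' t\<^sub>0"
    using C C' by (simp add: C_pattern_def)
  show "C t' = C' t'" if "adj k t t'" "C t = C' t" for k t t'
    unfolding C_pattern_step[OF C that(1)] C_pattern_step[OF C' that(1)] that(2) ..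
qed

lemma F_polynomials_step:
  assumes "F_polynomials n r adj t\<^sub>0 B C F" and "adj k t t'"
  shows "F t' = vec n (\<lambda>i. if i = k
          then inverse (F t $ k) *
               (\<Prod>j<n. of_poly (pvar j) powi pos (- C t $$ (j, k)) *
                       (F t $ j) powi pos (- B t $$ (j, k))) ^ r k *
               (\<Sum>s\<le>r k. of_coeff (z_coeff r k s) *
                  (\<Prod>j<n. of_poly (pvar j) powi (C t $$ (j, k)) *
                          (F t $ j) powi (B t $$ (j, k))) ^ s)
          else F t $ i)"
  using assms unfolding F_polynomials_def by fastforce

section \<open>f-vectors as top exponents\<close>

lemma is_f_vector_iff:
  "is_f_vector n f v \<longleftrightarrow>
     (\<exists>p u. f = of_poly p \<and> has_top p u \<and> v = vec n (\<lambda>j. int (Poly_Mapping.lookup u j)))"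
  unfolding is_f_vector_def has_top_def exponents_le_def by blast

text \<open>Two tops of the same polynomial both occur in it, so each dominates the other.\<close>

lemma is_f_vector_unique:
  assumes "is_f_vector n f v" and "is_f_vector n f w"
  shows "v = w"
proof -
  from assms(1) obtain p u where p: "f = of_poly p" "has_top p u"
    and v: "v = vec n (\<lambda>j. int (Poly_Mapping.lookup u j))"
    by (auto simp: is_f_vector_iff)
  from assms(2) p(1) obtain x where x: "has_top p x"
    and w: "w = vec n (\<lambda>j. int (Poly_Mapping.lookup x j))"
    by (auto simp: is_f_vector_iff)
  have "Poly_Mapping.lookup u j = Poly_Mapping.lookup x j" for j
    using p x exponents_leD[of p u x j] exponents_leD[of p x u j] by (simp add: has_top_def)
  then show ?thesis by (simp add: v w)
qed

lemma is_f_vector_one: "is_f_vector n 1 (0\<^sub>v n)"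
  unfolding is_f_vector_iff
  by (intro exI[of _ 1] exI[of _ 0] conjI has_top_one) (auto simp: zero_vec_def)

section \<open>Principal parts of the exchange matrices\<close>

text \<open>The number \<open>d k * B $$ (k, k)\<close> equals its own negative. The zero diagonal
  makes the changing column of the F-matrix drop out of column \<open>k\<close> of its product with
  \<open>B\<close>.\<close>

lemma skew_symmetrizable_diag:
  assumes "skew_symmetrizable n B" and "k < n"
  shows "B $$ (k, k) = 0"
proof -
  from assms obtain d where B: "B \<in> carrier_mat n n" and d: "d k > 0"
    and skew: "transpose_mat (mat_diag n d * B) = - (mat_diag n d * B)"
    by (auto simp: skew_symmetrizable_def)
  from skew have "transpose_mat (mat_diag n d * B) $$ (k, k) = (- (mat_diag n d * B)) $$ (k, k)"
    by simp
  then have "d k * B $$ (k, k) = - (d k * B $$ (k, k))"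
    using B assms(2) by (simp add: mat_diag_mult_left)
  with d show ?thesis by simp
qed

lemma cluster_pattern_B_diag:
  assumes "cluster_pattern m n r V adj \<Sigma>" and "t \<in> V" and "k < n"
  shows "pattern_B n \<Sigma> t $$ (k, k) = 0"
proof -
  obtain x B where "\<Sigma> t = (x, B)" by fastforce
  moreover from assms(1,2) have "is_seed m n r (\<Sigma> t)"
    by (simp add: cluster_pattern_def)
  ultimately show ?thesis
    using assms(3) by (auto simp: pattern_B_def intro: skew_symmetrizable_diag)
qed

text \<open>Mutation in a direction \<open>k < n\<close> uses only row \<open>k\<close> and column
  \<open>k\<close>, so principal parts mutate among themselves; \<open>n \<le> m\<close> makes their
  rows rows of the full matrix.\<close>

lemma cluster_pattern_B_step:
  assumes "cluster_pattern m n r V adj \<Sigma>" and "adj k t t'" and "n \<le> m" and "k < n" "i < n" "j < n"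
  defines "B \<equiv> pattern_B n \<Sigma> t"
  shows "pattern_B n \<Sigma> t' $$ (i, j) = (if i = k \<or> j = k then - B $$ (i, j)
    else B $$ (i, j) + int (r k) *
      (pos (- B $$ (i, k)) * B $$ (k, j) + B $$ (i, k) * pos (B $$ (k, j))))"
proof -
  obtain x A where t: "\<Sigma> t = (x, A)" by fastforce
  have "\<Sigma> t' = seed_mutation m n r 1 k (\<Sigma> t)"
    using assms(1,2) by (auto simp: cluster_pattern_def)
  then show ?thesis
    using assms(3-6) by (auto simp: B_def t pattern_B_def principal_part_def Let_def)
qed

section \<open>Entries of the mutation formula\<close>

lemma F_mutation_dims:
  assumes "M \<in> carrier_mat n n" "B \<in> carrier_mat n n" "C \<in> carrier_mat n n" "C' \<in> carrier_mat n n"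
  shows "F_mutation n r \<epsilon> k B C C' M \<in> carrier_mat n n"
  using assms by (simp add: F_mutation_def only_col_def J_mat_def R_mat_def pos_mat_def mat_diag_def)

lemma F_mutation_index:
  assumes dims: "M \<in> carrier_mat n n" "B \<in> carrier_mat n n" "C \<in> carrier_mat n n" "C' \<in> carrier_mat n n"
    and a: "a < n" and l: "l < n"
  shows "F_mutation n r \<epsilon> k B C C' M $$ (a, l) = (if l = k then - M $$ (a, k) +
      int (r k) * ((\<Sum>i<n. M $$ (a, i) * pos (- \<epsilon> * B $$ (i, k))) +
        pos (- \<epsilon> * C $$ (a, k)) + pos (\<epsilon> * C' $$ (a, k)))
    else M $$ (a, l))"
proof -
  have entry: "only_col k (pos_mat (\<delta> \<cdot>\<^sub>m (A * R_mat n r))) $$ (i, l) =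
      (if l = k then int (r k) * pos (\<delta> * A $$ (i, k)) else 0)"
    if "A \<in> carrier_mat n n" "i < n" for A \<delta> i
  proof -
    \<comment> \<open>\<open>R\<close> scales columns by nonnegative numbers, which pass through
      \<open>pos\<close>.\<close>
    have "pos (\<delta> * (x * int y)) = int y * pos (\<delta> * x)" for x y
      using pos_mult_left[of "int y" "\<delta> * x"] by (simp add: mult_ac)
    with that l show ?thesis
      by (auto simp: only_col_def pos_mat_def R_mat_def mat_diag_mult_right)
  qed
  have dims_col: "only_col k (pos_mat (\<delta> \<cdot>\<^sub>m (A * R_mat n r))) \<in> carrier_mat n n"
    if "A \<in> carrier_mat n n" for A \<delta>
    using that by (simp add: only_col_def pos_mat_def R_mat_def mat_diag_def)
  have J: "J_mat n k \<in> carrier_mat n n"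
    by (simp add: J_mat_def)
  have J_entry: "J_mat n k $$ (i, l) = (if i = l then if i = k then - 1 else 1 else 0)" if "i < n" for i
    using that l by (simp add: J_mat_def mat_diag_def)
  have "(M * (J_mat n k + only_col k (pos_mat ((- \<epsilon>) \<cdot>\<^sub>m (B * R_mat n r))))) $$ (a, l) =
      (\<Sum>i<n. M $$ (a, i) * ((if i = l then if i = k then - 1 else 1 else 0) +
        (if l = k then int (r k) * pos (- \<epsilon> * B $$ (i, k)) else 0)))"
    using a l dims J dims_col[OF dims(2), of "- \<epsilon>"]
    by (auto simp: scalar_prod_def J_entry entry lessThan_atLeast0 intro!: sum.cong)
  also have "\<dots> = (if l = k then - M $$ (a, k) + int (r k) * (\<Sum>i<n. M $$ (a, i) * pos (- \<epsilon> * B $$ (i, k)))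
      else M $$ (a, l))"
  proof (cases "l = k")
    case True
    then have "M $$ (a, i) * ((if i = l then if i = k then - 1 else 1 else 0) +
          (if l = k then int (r k) * pos (- \<epsilon> * B $$ (i, k)) else 0)) =
        (if i = k then - M $$ (a, k) else 0) + int (r k) * (M $$ (a, i) * pos (- \<epsilon> * B $$ (i, k)))" for i
      by (simp add: algebra_simps)
    with True l show ?thesis
      by (simp add: sum.distrib flip: sum_distrib_left)
  next
    case False
    then have "M $$ (a, i) * ((if i = l then if i = k then - 1 else 1 else 0) +
          (if l = k then int (r k) * pos (- \<epsilon> * B $$ (i, k)) else 0)) =
        (if i = l then M $$ (a, l) else 0)" for i
      by simp
    with False l show ?thesis by simp
  qed
  finally have "(M * (J_mat n k + only_col k (pos_mat ((- \<epsilon>) \<cdot>\<^sub>m (B * R_mat n r))))) $$ (a, l) = \<dots>" .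
  moreover have "F_mutation n r \<epsilon> k B C C' M $$ (a, l) =
      (M * (J_mat n k + only_col k (pos_mat ((- \<epsilon>) \<cdot>\<^sub>m (B * R_mat n r))))) $$ (a, l) +
      only_col k (pos_mat ((- \<epsilon>) \<cdot>\<^sub>m (C * R_mat n r))) $$ (a, l) +
      only_col k (pos_mat (\<epsilon> \<cdot>\<^sub>m (C' * R_mat n r))) $$ (a, l)"
    using a l dims(1) J dims_col[OF dims(2), of "- \<epsilon>"] dims_col[OF dims(3), of "- \<epsilon>"]
      dims_col[OF dims(4), of \<epsilon>]
    \<comment> \<open>The matrix product stays unevaluated so that the entry computed above can
      replace it.\<close>
    unfolding F_mutation_def by (auto simp del: index_mult_mat(1))
  ultimately show ?thesis
    using a dims by (simp add: entry distrib_left)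
qed

lemma C_pattern_carrier:
  assumes "labeled_regular_tree n V adj" "t\<^sub>0 \<in> V" "t \<in> V" "C_pattern n r adj t\<^sub>0 B C"
  shows "C t \<in> carrier_mat n n"
  using assms(1-3)
proof (rule labeled_regular_tree_induct)
  show "C t\<^sub>0 \<in> carrier_mat n n"
    using assms(4) by (simp add: C_pattern_def)
  show "C t' \<in> carrier_mat n n" if "adj k t t'" for k t t'
    by (simp add: C_pattern_step[OF assms(4) that])
qed

lemma pattern_B_carrier [simp]: "pattern_B n \<Sigma> t \<in> carrier_mat n n"
  by (simp add: pattern_B_def principal_part_def)

section \<open>Exchange relation and initial value for F-matrices\<close>

text \<open>The f-vectors are the columns, so row \<open>a\<close> of column \<open>k\<close> is
  coordinate \<open>a\<close> in \<open>f_vectors_exchange\<close>. The other columns stay because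
  their F-polynomials stay and f-vectors are unique.\<close>

lemma F_pattern_exchange:
  assumes tree: "labeled_regular_tree n V adj" "t\<^sub>0 \<in> V"
    and C: "C_pattern n r adj t\<^sub>0 B C" and F: "F_pattern n r V adj t\<^sub>0 B F"
    and edge: "adj k t t'" and a: "a < n"
  shows "F t' $$ (a, k) + F t $$ (a, k) = int (r k) *
      max (pos (C t $$ (a, k)) + (\<Sum>i<n. F t $$ (a, i) * pos (B t $$ (i, k))))
        (pos (- C t $$ (a, k)) + (\<Sum>i<n. F t $$ (a, i) * pos (- B t $$ (i, k))))"
    and "l < n \<Longrightarrow> l \<noteq> k \<Longrightarrow> F t' $$ (a, l) = F t $$ (a, l)"
proof -
  note V = labeled_regular_treeD[OF tree(1) edge]
  from F obtain C0 P where C0: "C_pattern n r adj t\<^sub>0 B C0"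
    and P: "F_polynomials n r adj t\<^sub>0 B C0 P" and M: "\<And>t. t \<in> V \<Longrightarrow> is_F_matrix n (P t) (F t)"
    by (auto simp: F_pattern_def)
  have [simp]: "C0 t = C t"
    using C_pattern_unique[OF tree V(2) C0 C] .
  have fvec: "is_f_vector n (P s $ i) (col (F s) i)" if "s \<in> V" "i < n" for s i
    using M that by (auto simp: is_F_matrix_def)
  have carrier: "F s \<in> carrier_mat n n" if "s \<in> V" for s
    using M that by (auto simp: is_F_matrix_def)
  have entry: "F s $$ (a, i) = col (F s) i $ a" if "s \<in> V" "i < n" for s i
    using carrier[OF that(1)] that a by simp
  from fvec[OF V(2)] obtain p u where pu: "\<And>i. i < n \<Longrightarrow> P t $ i = of_poly (p i)"
      "\<And>i. i < n \<Longrightarrow> has_top (p i) (u i)"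
      "\<And>i. i < n \<Longrightarrow> col (F t) i = vec n (\<lambda>j. int (Poly_Mapping.lookup (u i) j))"
    unfolding is_f_vector_iff by metis
  from fvec[OF V(3,1)] obtain p' u' where pu': "P t' $ k = of_poly p'" "has_top p' u'"
      "col (F t') k = vec n (\<lambda>j. int (Poly_Mapping.lookup u' j))"
    unfolding is_f_vector_iff by metis
  have F_t: "int (Poly_Mapping.lookup (u i) a) = F t $$ (a, i)" if "i < n" for i
    using a that V(2) by (simp add: entry pu(3))
  have F_t': "int (Poly_Mapping.lookup u' a) = F t' $$ (a, k)"
    using a V by (simp add: entry pu'(3))
  have "of_poly p' = inverse (of_poly (p k)) *
      (\<Prod>j<n. of_poly (pvar j) powi pos (- C t $$ (j, k)) * of_poly (p j) powi pos (- B t $$ (j, k))) ^ r k *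
      (\<Sum>s\<le>r k. of_coeff (z_coeff r k s) *
        (\<Prod>j<n. of_poly (pvar j) powi (C t $$ (j, k)) * of_poly (p j) powi (B t $$ (j, k))) ^ s)"
    unfolding pu'(1)[symmetric] F_polynomials_step[OF P edge] using V(1) by (simp add: pu(1))
  from f_vectors_exchange[OF pu(2) pu'(2) V(1) this a]
  show "F t' $$ (a, k) + F t $$ (a, k) = int (r k) *
      max (pos (C t $$ (a, k)) + (\<Sum>i<n. F t $$ (a, i) * pos (B t $$ (i, k))))
        (pos (- C t $$ (a, k)) + (\<Sum>i<n. F t $$ (a, i) * pos (- B t $$ (i, k))))"
    using V(1) by (simp add: F_t F_t')
  show "F t' $$ (a, l) = F t $$ (a, l)" if "l < n" "l \<noteq> k"
  proof -
    have "P t' $ l = P t $ l"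
      unfolding F_polynomials_step[OF P edge] using that by simp
    then have "col (F t') l = col (F t) l"
      using fvec[OF V(2) that(1)] fvec[OF V(3) that(1)] is_f_vector_unique by metis
    then show ?thesis
      using that V by (simp add: entry)
  qed
qed

lemma F_pattern_root:
  assumes "t\<^sub>0 \<in> V" and "F_pattern n r V adj t\<^sub>0 B F"
  shows "F t\<^sub>0 = 0\<^sub>m n n"
proof -
  from assms obtain P where "P t\<^sub>0 = vec n (\<lambda>_. 1)" and M: "is_F_matrix n (P t\<^sub>0) (F t\<^sub>0)"
    by (auto simp: F_pattern_def F_polynomials_def)
  then have "col (F t\<^sub>0) i = 0\<^sub>v n" if "i < n" for i
    using that is_f_vector_unique[OF _ is_f_vector_one] by (simp add: is_F_matrix_def)
  then have "F t\<^sub>0 $$ (a, i) = 0" if "a < n" "i < n" for a i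
    using that M by (metis carrier_matD index_col index_zero_vec(1) is_F_matrix_def)
  with M show ?thesis
    by (intro eq_matI) (auto simp: is_F_matrix_def)
qed

section \<open>Relation between the two families of C-matrices\<close>

text \<open>Since \<open>pos c - pos (- c) = c\<close>, the arguments of \<open>max\<close> differ
  by \<open>c'\<close>, and a maximum is either argument plus a positive part of the difference. The
  two readings yield the signs 1 and -1 of the mutation formula.\<close>

lemma max_pos_conv:
  assumes "c' = c + (x - y)"
  shows "max (pos c + x) (pos (- c) + y) = y + pos (- c) + pos c'"
    and "max (pos c + x) (pos (- c) + y) = x + pos c + pos (- c')"
  using assms by (auto simp: pos_def)

lemma sum_pos_diff:
  fixes f b :: "nat \<Rightarrow> int"
  shows "(\<Sum>i<n. f i * b i) = (\<Sum>i<n. f i * pos (b i)) - (\<Sum>i<n. f i * pos (- b i))"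
  by (simp add: pos_minus algebra_simps sum_subtractf)

text \<open>The induction works because the hypothesis in column \<open>k\<close> turns the maximum
  in the exchange relation into positive parts of entries of \<open>Cp t\<close> and
  \<open>Cm t\<close>, the quantities in the two C-recursions.\<close>

lemma C_minus_eq:
  assumes nm: "n \<le> m"
    and tree: "labeled_regular_tree n V adj" "t\<^sub>0 \<in> V" "t \<in> V"
    and pat: "cluster_pattern m n r V adj \<Sigma>"
    and Cp: "C_pattern n r adj t\<^sub>0 (pattern_B n \<Sigma>) Cp"
    and Cm: "C_pattern n r adj t\<^sub>0 (\<lambda>t. - pattern_B n \<Sigma> t) Cm"
    and F: "F_pattern n r V adj t\<^sub>0 (pattern_B n \<Sigma>) F"
  shows "\<forall>a<n. \<forall>j<n. Cm t $$ (a, j) = Cp t $$ (a, j) + (\<Sum>i<n. F t $$ (a, i) * pattern_B n \<Sigma> t $$ (i, j))"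
  using tree
proof (rule labeled_regular_tree_induct)
  show "\<forall>a<n. \<forall>j<n. Cm t\<^sub>0 $$ (a, j) = Cp t\<^sub>0 $$ (a, j) + (\<Sum>i<n. F t\<^sub>0 $$ (a, i) * pattern_B n \<Sigma> t\<^sub>0 $$ (i, j))"
    using Cp Cm F_pattern_root[OF tree(2) F] by (simp add: C_pattern_def)
next
  fix k t t'
  assume edge: "adj k t t'"
    and IH: "\<forall>a<n. \<forall>j<n. Cm t $$ (a, j) = Cp t $$ (a, j) + (\<Sum>i<n. F t $$ (a, i) * pattern_B n \<Sigma> t $$ (i, j))"
  note V = labeled_regular_treeD[OF tree(1) edge]
  define B where "B = pattern_B n \<Sigma> t"
  have dim_B [simp]: "dim_row B = n" "dim_col B = n"
    by (simp_all add: B_def pattern_B_def principal_part_def)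
  have B_kk: "B $$ (k, k) = 0"
    using cluster_pattern_B_diag[OF pat V(2,1)] by (simp add: B_def)
  note B_step = cluster_pattern_B_step[OF pat edge nm V(1), folded B_def]
  note F_step = F_pattern_exchange[OF tree(1,2) Cp F edge, folded B_def]
  show "\<forall>a<n. \<forall>j<n. Cm t' $$ (a, j) = Cp t' $$ (a, j) + (\<Sum>i<n. F t' $$ (a, i) * pattern_B n \<Sigma> t' $$ (i, j))"
  proof (intro allI impI)
    fix a j
    assume a: "a < n" and j: "j < n"
    let ?f = "\<lambda>i. F t $$ (a, i)"
    show "Cm t' $$ (a, j) = Cp t' $$ (a, j) + (\<Sum>i<n. F t' $$ (a, i) * pattern_B n \<Sigma> t' $$ (i, j))"
    proof (cases "j = k")
      case True
      \<comment> \<open>Column \<open>k\<close> of the exchange matrix only changes sign, and the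
        one column of \<open>F\<close> that changes is multiplied by
        \<open>B $$ (k, k) = 0\<close>.\<close>
      have "(\<Sum>i<n. F t' $$ (a, i) * pattern_B n \<Sigma> t' $$ (i, k)) = (\<Sum>i<n. - (?f i * B $$ (i, k)))"
      proof (intro sum.cong refl)
        fix i
        assume "i \<in> {..<n}"
        then show "F t' $$ (a, i) * pattern_B n \<Sigma> t' $$ (i, k) = - (?f i * B $$ (i, k))"
          using F_step(2)[OF a, of i] B_kk V(1) by (cases "i = k") (simp_all add: B_step)
      qed
      then show ?thesis
        unfolding True C_pattern_step[OF Cp edge] C_pattern_step[OF Cm edge]
        using a V(1) IH by (simp add: B_def sum_negf)
    next
      case False
      define c c' bkj where "c = Cp t $$ (a, k)" and "c' = Cm t $$ (a, k)" and "bkj = B $$ (k, j)"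
      define X Y where "X = (\<Sum>i<n. ?f i * pos (B $$ (i, k)))" and "Y = (\<Sum>i<n. ?f i * pos (- B $$ (i, k)))"
      have c': "c' = c + (X - Y)"
        using IH a V(1) unfolding X_def Y_def c_def c'_def B_def[symmetric]
        by (simp flip: sum_pos_diff)
      have Fk: "F t' $$ (a, k) = - ?f k + int (r k) * (Y + pos (- c) + pos c')"
        using F_step(1)[OF a] max_pos_conv(1)[OF c'] by (simp add: X_def Y_def c_def)
      \<comment> \<open>The last summand corrects \<open>i = k\<close>: the uniform expression gives
        \<open>?f k * bkj\<close> there, whereas the true product is
        \<open>- F t' $$ (a, k) * bkj\<close>.\<close>
      have "(\<Sum>i<n. F t' $$ (a, i) * pattern_B n \<Sigma> t' $$ (i, j)) =
          (\<Sum>i<n. ?f i * B $$ (i, j) + int (r k) *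
            (?f i * pos (- B $$ (i, k)) * bkj + ?f i * B $$ (i, k) * pos bkj) +
            (if i = k then - (F t' $$ (a, k) + ?f k) * bkj else 0))"
      proof (intro sum.cong refl)
        fix i
        assume "i \<in> {..<n}"
        then show "F t' $$ (a, i) * pattern_B n \<Sigma> t' $$ (i, j) =
            ?f i * B $$ (i, j) + int (r k) *
            (?f i * pos (- B $$ (i, k)) * bkj + ?f i * B $$ (i, k) * pos bkj) +
            (if i = k then - (F t' $$ (a, k) + ?f k) * bkj else 0)"
          using F_step(2)[OF a, of i] B_kk V(1) j False
          by (cases "i = k") (simp_all add: B_step bkj_def algebra_simps, simp add: pos_def)
      qed
      also have "\<dots> = (\<Sum>i<n. ?f i * B $$ (i, j)) + int (r k) * (Y * bkj + (X - Y) * pos bkj) -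
          (F t' $$ (a, k) + ?f k) * bkj"
        using V(1) unfolding X_def Y_def sum_pos_diff[symmetric]
        by (simp add: sum.distrib sum_distrib_left sum_distrib_right algebra_simps)
      finally have "(\<Sum>i<n. F t' $$ (a, i) * pattern_B n \<Sigma> t' $$ (i, j)) =
          (\<Sum>i<n. ?f i * B $$ (i, j)) + int (r k) * ((X - Y) * pos bkj - (pos (- c) + pos c') * bkj)"
        unfolding Fk by (simp add: algebra_simps)
      moreover have "Cp t' $$ (a, j) = Cp t $$ (a, j) + int (r k) * (c * pos bkj + pos (- c) * bkj)"
        unfolding C_pattern_step[OF Cp edge] using a j False by (simp add: c_def bkj_def B_def)
      \<comment> \<open>This recursion runs with \<open>- B\<close>, so \<open>bkj\<close> enters
        negated.\<close>
      moreover have "Cm t' $$ (a, j) = Cm t $$ (a, j) + int (r k) * (c' * pos (- bkj) - pos (- c') * bkj)"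
        unfolding C_pattern_step[OF Cm edge] B_def[symmetric] using a j False V(1)
        by (simp add: c'_def bkj_def)
      moreover have "Cm t $$ (a, j) = Cp t $$ (a, j) + (\<Sum>i<n. ?f i * B $$ (i, j))"
        using IH a j by (simp add: B_def)
      \<comment> \<open>On both sides the change is
        \<open>int (r k) * (c' * pos bkj - pos c' * bkj)\<close>.\<close>
      ultimately show ?thesis
        unfolding c' pos_minus by (simp add: algebra_simps)
    qed
  qed
qed

section \<open>The mutation formula and uniqueness\<close>

lemma F_pattern_mutation:
  assumes nm: "n \<le> m"
    and tree: "labeled_regular_tree n V adj" "t\<^sub>0 \<in> V"
    and pat: "cluster_pattern m n r V adj \<Sigma>"
    and Cp: "C_pattern n r adj t\<^sub>0 (pattern_B n \<Sigma>) Cp"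
    and Cm: "C_pattern n r adj t\<^sub>0 (\<lambda>t. - pattern_B n \<Sigma> t) Cm"
    and F: "F_pattern n r V adj t\<^sub>0 (pattern_B n \<Sigma>) F"
    and edge: "adj k t t'" and \<epsilon>: "\<epsilon> \<in> {1, -1}"
  shows "F t' = F_mutation n r \<epsilon> k (pattern_B n \<Sigma> t) (Cp t) (Cm t) (F t)"
proof -
  note V = labeled_regular_treeD[OF tree(1) edge]
  let ?B = "pattern_B n \<Sigma> t"
  have F_carrier: "F s \<in> carrier_mat n n" if "s \<in> V" for s
    using F that by (auto simp: F_pattern_def is_F_matrix_def)
  note dims = F_carrier[OF V(2)] pattern_B_carrier[of n \<Sigma> t] C_pattern_carrier[OF tree V(2) Cp]
    C_pattern_carrier[OF tree V(2) Cm]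
  have "F t' $$ (a, l) = F_mutation n r \<epsilon> k ?B (Cp t) (Cm t) (F t) $$ (a, l)" if a: "a < n" and l: "l < n" for a l
  proof (cases "l = k")
    case True
    let ?X = "\<Sum>i<n. F t $$ (a, i) * pos (?B $$ (i, k))"
    let ?Y = "\<Sum>i<n. F t $$ (a, i) * pos (- ?B $$ (i, k))"
    \<comment> \<open>The arguments of the maximum in the exchange relation thus differ by an entry
      of \<open>Cm t\<close>, as \<open>max_pos_conv\<close> requires.\<close>
    have "Cm t $$ (a, k) = Cp t $$ (a, k) + (?X - ?Y)"
      using C_minus_eq[OF nm tree V(2) pat Cp Cm F] a V(1) by (simp flip: sum_pos_diff)
    from F_pattern_exchange(1)[OF tree Cp F edge a] max_pos_conv[OF this]
    have "F t' $$ (a, k) + F t $$ (a, k) = int (r k) * ((\<Sum>i<n. F t $$ (a, i) * pos (- \<epsilon> * ?B $$ (i, k))) +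
        pos (- \<epsilon> * Cp t $$ (a, k)) + pos (\<epsilon> * Cm t $$ (a, k)))"
      using \<epsilon> by auto
    then show ?thesis
      using F_mutation_index[OF dims a V(1), of r \<epsilon> k] True by simp
  next
    case False
    then show ?thesis
      using F_pattern_exchange(2)[OF tree Cp F edge a l] by (simp add: F_mutation_index[OF dims a l])
  qed
  then show ?thesis
    using F_carrier[OF V(3)] F_mutation_dims[OF dims, of r \<epsilon> k] by (intro eq_matI) auto
qed

theorem proposition3p5:
  fixes m n :: nat and r :: "nat \<Rightarrow> nat"
    and V :: "'v set" and adj :: "nat \<Rightarrow> 'v \<Rightarrow> 'v \<Rightarrow> bool" and t\<^sub>0 :: 'v
    and \<Sigma> :: "'v \<Rightarrow> seed"
    and C_plus C_minus F :: "'v \<Rightarrow> int mat"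
  assumes "1 \<le> n" and "n \<le> m" and "\<forall>i<n. 1 \<le> r i"
    and "labeled_regular_tree n V adj" and "t\<^sub>0 \<in> V"
    and "cluster_pattern m n r V adj \<Sigma>"
    and "C_pattern n r adj t\<^sub>0 (pattern_B n \<Sigma>) C_plus"
    and "C_pattern n r adj t\<^sub>0 (\<lambda>t. - pattern_B n \<Sigma> t) C_minus"
    and "F_pattern n r V adj t\<^sub>0 (pattern_B n \<Sigma>) F"
  shows "F t\<^sub>0 = 0\<^sub>m n n \<and>
    (\<forall>k t t'. adj k t t' \<longrightarrow> (\<forall>\<epsilon>\<in>{1, -1}.
       F t' = F_mutation n r \<epsilon> k (pattern_B n \<Sigma> t) (C_plus t) (C_minus t) (F t))) \<and>
    (\<forall>G. \<forall>\<epsilon>\<in>{1, -1}. G t\<^sub>0 = 0\<^sub>m n n \<and>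
       (\<forall>k t t'. adj k t t' \<longrightarrow>
          G t' = F_mutation n r \<epsilon> k (pattern_B n \<Sigma> t) (C_plus t) (C_minus t) (G t))
       \<longrightarrow> (\<forall>t\<in>V. G t = F t))"
proof -
  have mutation: "F t' = F_mutation n r \<epsilon> k (pattern_B n \<Sigma> t) (C_plus t) (C_minus t) (F t)"
    if "adj k t t'" "\<epsilon> \<in> {1, -1}" for k t t' \<epsilon>
    using F_pattern_mutation[OF assms(2,4-9) that] .
  have root: "F t\<^sub>0 = 0\<^sub>m n n"
    by (rule F_pattern_root[OF assms(5,9)])
  \<comment> \<open>\<open>F\<close> obeys the recursion for both signs, hence for the single sign
    assumed for \<open>G\<close>; agreement at the root spreads along edges.\<close>
  have "G t = F t"
    if "\<epsilon> \<in> {1, -1}" "G t\<^sub>0 = 0\<^sub>m n n" "t \<in> V" and G: "\<And>k t t'. adj k t t' \<Longrightarrow>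
      G t' = F_mutation n r \<epsilon> k (pattern_B n \<Sigma> t) (C_plus t) (C_minus t) (G t)" for G \<epsilon> t
    using assms(4,5) \<open>t \<in> V\<close>
  proof (rule labeled_regular_tree_induct)
    show "G t\<^sub>0 = F t\<^sub>0"
      using that(2) root by simp
    show "G t' = F t'" if "adj k t t'" "G t = F t" for k t t'
      using G[OF that(1)] mutation[OF that(1) \<open>\<epsilon> \<in> {1, -1}\<close>] that(2) by simp
  qed
  with root mutation show ?thesis by blast
qed

end
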